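(* Let $A$ be a nonsingular $n\times n$ matrix, let $M$ and $F$ be $n\times n$ matrices, and let $\|\cdot\|$ be an induced matrix norm. Assume that $\|AM-I\|\le\varepsilon<1$. Then $M$ is nonsingular. Let $M_d=M-F$. If $$\|F\|\le\min\left\{\frac{\varepsilon}{\|A\|},\frac{1-\varepsilon}{\|A\|}\right\},$$ then $M_d$ is nonsingular and $$\|AM_d-I\|\le\min\{1,2\varepsilon\}.$$ Specifically, if in addition $\varepsilon<0.5$, then $$\|F\|\le\frac{\varepsilon}{\|A\|}\quad\text{and}\quad\|AM_d-I\|\le 2\varepsilon.$$
   Context: Matrices are real or complex; $I$ is the $n\times n$ identity matrix. The matrix norm $\|\cdot\|$ is an arbitrary induced (operator) matrix norm, i.e. induced by a vector norm on $n$-dimensional space (for example the matrix 1-norm or 2-norm).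
   Formalization: For ε ≥ 1/2, nonsingularity of M_d is claimed only if ‖AM−I‖ < ε or ‖F‖ < (1−ε)/‖A‖ holds strictly; as printed it fails, e.g. n=1, A=1, M=F=1/2, ε=1/2 gives M_d=0. *)

theory Defs
  imports "HOL-Analysis.Analysis"
begin

text \<open>
  Scalars range over types of sort \<open>{real_normed_field, euclidean_space}\<close>, which has both \<^typ>\<open>real\<close>
  and \<^typ>\<open>complex\<close> as instances, so that a statement over this sort covers both real and complex
  matrices at once.
\<close>

definition is_vector_norm :: "('a::real_normed_field ^ 'n \<Rightarrow> real) \<Rightarrow> bool" where
  "is_vector_norm N \<longleftrightarrow>
     (\<forall>x. N x \<ge> 0) \<and>
     (\<forall>x. N x = 0 \<longleftrightarrow> x = 0) \<and>
     (\<forall>c x. N (c *s x) = norm c * N x) \<and>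
     (\<forall>x y. N (x + y) \<le> N x + N y)"

text \<open>
  The library's \<^const>\<open>onorm\<close> is tied to the canonical norm of the type (the Euclidean one on
  vectors); here the vector norm \<open>N\<close> is arbitrary. For finite-dimensional scalars the set
  under the supremum is bounded, so the supremum is a genuine one.
\<close>

definition induced_norm ::
  "('a::real_normed_field ^ 'n \<Rightarrow> real) \<Rightarrow> 'a ^ 'n ^ 'n \<Rightarrow> real" where
  "induced_norm N A = (SUP x\<in>{x. x \<noteq> 0}. N (A *v x) / N x)"

end

theory Submission
  imports Defs
begin

text \<open>
  If \<open>\<parallel>AX - I\<parallel> < 1\<close> then \<open>X\<close> has trivial kernel, since \<open>X x = 0\<close> gives
  \<open>N x = N ((AX - I) x) \<le> \<parallel>AX - I\<parallel> N x\<close>. Both invertibility claims follow from this, because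
  \<open>A (M - F) - I = (AM - I) - AF\<close> has norm at most \<open>\<parallel>AM - I\<parallel> + \<parallel>A\<parallel> \<parallel>F\<parallel>\<close>.
\<close>

lemma vector_norm_nonneg: "is_vector_norm N \<Longrightarrow> 0 \<le> N x"
  and vector_norm_eq_0_iff: "is_vector_norm N \<Longrightarrow> N x = 0 \<longleftrightarrow> x = 0"
  and vector_norm_scale: "is_vector_norm N \<Longrightarrow> N (c *s x) = norm c * N x"
  and vector_norm_triangle: "is_vector_norm N \<Longrightarrow> N (x + y) \<le> N x + N y"
  by (simp_all add: is_vector_norm_def)

lemma vector_norm_pos_iff: "is_vector_norm N \<Longrightarrow> 0 < N x \<longleftrightarrow> x \<noteq> 0"
  by (metis less_le vector_norm_eq_0_iff vector_norm_nonneg)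

lemma vector_norm_minus: "is_vector_norm N \<Longrightarrow> N (- x) = N x"
  using vector_norm_scale[of N "- 1" x] by (simp add: vector_sneg_minus1[symmetric])

lemma vector_norm_diff: "is_vector_norm N \<Longrightarrow> N (x - y) \<le> N x + N y"
  using vector_norm_triangle[of N x "- y"] by (simp add: vector_norm_minus)

lemma vector_norm_sum:
  assumes "is_vector_norm N"
  shows "N (sum f S) \<le> (\<Sum>i\<in>S. N (f i))"
proof (induction S rule: infinite_finite_induct)
  case (insert i S)
  then show ?case using vector_norm_triangle[OF assms, of "f i" "sum f S"] by simp
qed (use vector_norm_eq_0_iff[OF assms, of 0] in simp_all)

text \<open>Expand \<open>B *v x\<close> as a combination of the columns of \<open>B\<close>; each
  coordinate of \<open>x\<close> is at most its Euclidean norm. Taking \<open>B = mat 1\<close>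
  bounds \<open>N\<close> itself by a multiple of \<open>norm\<close>.\<close>

lemma vector_norm_mult_le_norm:
  fixes B :: "'a::real_normed_field ^ 'n ^ 'n"
  assumes "is_vector_norm N"
  shows "N (B *v x) \<le> (\<Sum>i\<in>UNIV. N (column i B)) * norm x"
proof -
  have "N (B *v x) = N (\<Sum>i\<in>UNIV. x $ i *s column i B)"
    by (simp add: matrix_mult_sum)
  also have "\<dots> \<le> (\<Sum>i\<in>UNIV. norm (x $ i) * N (column i B))"
    using vector_norm_sum[OF assms, of "\<lambda>i. x $ i *s column i B" UNIV]
    by (simp add: vector_norm_scale[OF assms])
  also have "\<dots> \<le> (\<Sum>i\<in>UNIV. norm x * N (column i B))"
    by (intro sum_mono mult_right_mono Finite_Cartesian_Product.norm_nth_le vector_norm_nonneg assms)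
  finally show ?thesis
    by (simp add: sum_distrib_left mult.commute)
qed

text \<open>By the triangle inequality in both directions, \<open>N x\<close> and \<open>N y\<close>
  differ by at most \<open>N (x - y)\<close>, so a bound of \<open>N\<close> by the Euclidean norm
  makes \<open>N\<close> Lipschitz.\<close>

lemma continuous_on_vector_norm:
  fixes N :: "'a::real_normed_field ^ 'n \<Rightarrow> real"
  assumes "is_vector_norm N"
  shows "continuous_on S N"
proof -
  define C where "C = (\<Sum>i\<in>UNIV. N (column i (mat 1)))"
  have bound: "N x \<le> C * norm x" for x
    using vector_norm_mult_le_norm[OF assms, of "mat 1" x] by (simp add: C_def)
  have "C-lipschitz_on S N"
  proof (rule lipschitz_onI)
    fix x y
    have "N x \<le> N y + N (x - y)" "N y \<le> N x + N (x - y)"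
      using vector_norm_triangle[OF assms, of y "x - y"] vector_norm_diff[OF assms, of x "x - y"]
      by simp_all
    then show "dist (N x) (N y) \<le> C * dist x y"
      using bound[of "x - y"] by (simp add: dist_norm)
  qed (simp add: C_def sum_nonneg vector_norm_nonneg[OF assms])
  then show ?thesis
    by (rule lipschitz_on_continuous_on)
qed

text \<open>The constant is the minimum of \<open>N\<close> on the Euclidean unit sphere. It is
  attained because the sphere is compact over finite-dimensional scalars, and it is positive because
  the sphere avoids 0.\<close>

lemma vector_norm_ge_norm:
  fixes N :: "'a::{real_normed_field, euclidean_space} ^ 'n \<Rightarrow> real"
  assumes "is_vector_norm N"
  obtains c where "c > 0" "\<And>x. c * norm x \<le> N x"
proof -
  let ?S = "sphere 0 1 :: ('a ^ 'n) set"
  obtain z where z: "z \<in> ?S" "\<And>y. y \<in> ?S \<Longrightarrow> N z \<le> N y"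
    using continuous_attains_inf[OF compact_sphere _ continuous_on_vector_norm[OF assms], of 0 1]
    by auto
  show ?thesis
  proof (rule that)
    show "N z > 0"
      using z(1) by (auto simp: vector_norm_pos_iff[OF assms])
    fix x :: "'a ^ 'n"
    show "N z * norm x \<le> N x"
    proof (cases "x = 0")
      case False
      have "N z \<le> N (inverse (norm x) *\<^sub>R x)"
        using False by (intro z(2)) simp
      \<comment> \<open>Homogeneity of \<open>N\<close> is stated for scalars in \<open>'a\<close>,
        so the real scaling is first turned into one by an element of \<open>'a\<close>.\<close>
      also have "inverse (norm x) *\<^sub>R x = (of_real (inverse (norm x)) :: 'a) *s x"
        by (simp add: vec_eq_iff scaleR_conv_of_real[where 'a = 'a])
      finally have "N z \<le> inverse (norm x) * N x"
        by (simp add: vector_norm_scale[OF assms] norm_inverse)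
      then show ?thesis
        using False by (simp add: field_simps)
    qed (simp add: vector_norm_nonneg[OF assms])
  qed
qed

text \<open>The supremum in \<open>induced_norm\<close> bounds its members only if the set is
  bounded above. The two comparisons with the Euclidean norm cancel \<open>norm x\<close> and leave
  \<open>K / c\<close>.\<close>

lemma bdd_above_induced_norm:
  fixes B :: "'a::{real_normed_field, euclidean_space} ^ 'n ^ 'n"
  assumes "is_vector_norm N"
  shows "bdd_above ((\<lambda>x. N (B *v x) / N x) ` {x. x \<noteq> 0})"
proof -
  obtain c where c: "c > 0" "\<And>x. c * norm x \<le> N x"
    using vector_norm_ge_norm[OF assms] by blast
  define K where "K = (\<Sum>i\<in>UNIV. N (column i B))"
  have "K \<ge> 0"
    by (simp add: K_def sum_nonneg vector_norm_nonneg[OF assms])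
  have "N (B *v x) / N x \<le> K / c" if "x \<noteq> 0" for x
  proof -
    have "N (B *v x) \<le> K * norm x"
      unfolding K_def by (rule vector_norm_mult_le_norm[OF assms])
    also have "\<dots> \<le> K * (N x / c)"
      using c \<open>K \<ge> 0\<close> by (intro mult_left_mono) (simp_all add: field_simps)
    finally show ?thesis
      using that by (simp add: vector_norm_pos_iff[OF assms] divide_le_eq)
  qed
  then show ?thesis
    by (intro bdd_aboveI2) auto
qed

lemma vector_norm_mult_le:
  fixes B :: "'a::{real_normed_field, euclidean_space} ^ 'n ^ 'n"
  assumes "is_vector_norm N"
  shows "N (B *v x) \<le> induced_norm N B * N x"
proof (cases "x = 0")
  case False
  then have "N (B *v x) / N x \<le> induced_norm N B"
    unfolding induced_norm_def by (intro cSUP_upper bdd_above_induced_norm[OF assms]) simp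
  then show ?thesis
    using False by (simp add: vector_norm_pos_iff[OF assms] divide_le_eq)
qed (use vector_norm_eq_0_iff[OF assms, of 0] in simp)

lemma induced_norm_le:
  fixes B :: "'a::real_normed_field ^ 'n ^ 'n"
  assumes "is_vector_norm N" and "\<And>x. N (B *v x) \<le> K * N x"
  shows "induced_norm N B \<le> K"
  unfolding induced_norm_def
proof (rule cSUP_least)
  \<comment> \<open>The all-ones vector shows that the supremum is over a nonempty set.\<close>
  have "(1 :: 'a ^ 'n) \<noteq> 0"
    by (simp add: vec_eq_iff)
  then show "{x :: 'a ^ 'n. x \<noteq> 0} \<noteq> {}"
    by blast
qed (use assms in \<open>simp add: vector_norm_pos_iff divide_le_eq\<close>)

lemma induced_norm_pos:
  fixes B :: "'a::{real_normed_field, euclidean_space} ^ 'n ^ 'n"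
  assumes "is_vector_norm N" and "B *v x \<noteq> 0"
  shows "induced_norm N B > 0"
proof -
  have "0 < N (B *v x)"
    using assms by (simp add: vector_norm_pos_iff)
  also have "\<dots> \<le> induced_norm N B * N x"
    by (rule vector_norm_mult_le[OF assms(1)])
  finally show ?thesis
    using vector_norm_nonneg[OF assms(1), of x] by (simp add: zero_less_mult_iff)
qed

lemma induced_norm_nonneg:
  fixes B :: "'a::{real_normed_field, euclidean_space} ^ 'n ^ 'n"
  assumes "is_vector_norm N"
  shows "induced_norm N B \<ge> 0"
proof -
  have "(1 :: 'a ^ 'n) \<noteq> 0"
    by (simp add: vec_eq_iff)
  moreover have "0 \<le> induced_norm N B * N 1"
    using vector_norm_nonneg[OF assms] vector_norm_mult_le[OF assms] by (rule order_trans)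
  ultimately show ?thesis
    by (metis assms vector_norm_pos_iff zero_le_mult_iff not_less)
qed

lemma induced_norm_diff:
  fixes B C :: "'a::{real_normed_field, euclidean_space} ^ 'n ^ 'n"
  assumes "is_vector_norm N"
  shows "induced_norm N (B - C) \<le> induced_norm N B + induced_norm N C"
proof (rule induced_norm_le[OF assms])
  fix x
  have "N ((B - C) *v x) \<le> N (B *v x) + N (C *v x)"
    by (simp add: matrix_vector_mult_diff_rdistrib vector_norm_diff[OF assms])
  then show "N ((B - C) *v x) \<le> (induced_norm N B + induced_norm N C) * N x"
    using vector_norm_mult_le[OF assms, of B x] vector_norm_mult_le[OF assms, of C x]
    by (simp add: distrib_right)
qed

lemma induced_norm_mult:
  fixes B C :: "'a::{real_normed_field, euclidean_space} ^ 'n ^ 'n"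
  assumes "is_vector_norm N"
  shows "induced_norm N (B ** C) \<le> induced_norm N B * induced_norm N C"
proof (rule induced_norm_le[OF assms])
  fix x
  have "N ((B ** C) *v x) \<le> induced_norm N B * N (C *v x)"
    using vector_norm_mult_le[OF assms, of B "C *v x"] by (simp add: matrix_vector_mul_assoc)
  also have "\<dots> \<le> induced_norm N B * (induced_norm N C * N x)"
    by (intro mult_left_mono vector_norm_mult_le induced_norm_nonneg assms)
  finally show "N ((B ** C) *v x) \<le> induced_norm N B * induced_norm N C * N x"
    by (simp add: mult.assoc)
qed

lemma invertible_if_approx_right_inverse:
  fixes A X :: "'a::{real_normed_field, euclidean_space} ^ 'n ^ 'n"
  assumes N: "is_vector_norm N" and lt: "induced_norm N (A ** X - mat 1) < 1"
  shows "invertible X"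
proof -
  have "x = 0" if "X *v x = 0" for x
  proof (rule ccontr)
    assume "x \<noteq> 0"
    have "(A ** X - mat 1) *v x = - x"
      using that by (simp add: matrix_vector_mult_diff_rdistrib matrix_vector_mul_assoc[symmetric])
    then have "N x \<le> induced_norm N (A ** X - mat 1) * N x"
      using vector_norm_mult_le[OF N, of "A ** X - mat 1" x] by (simp add: vector_norm_minus[OF N])
    with \<open>x \<noteq> 0\<close> lt show False
      by (simp add: vector_norm_pos_iff[OF N])
  qed
  then show ?thesis
    by (simp add: invertible_left_inverse matrix_left_invertible_ker)
qed

text \<open>Invertibility of \<open>M - F\<close> asks for strictness in one of the two bounds, or
  for \<epsilon> < 1/2: with \<open>A\<close> the identity, \<open>M\<close> and \<open>F\<close>
  both half the identity and \<epsilon> = 1/2, all non-strict bounds hold, yet \<open>M - F\<close>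
  is zero.\<close>

theorem theorem3p2:
  fixes A M F :: "'a::{real_normed_field, euclidean_space} ^ 'n ^ 'n"
    and N :: "'a ^ 'n \<Rightarrow> real"
    and \<epsilon> :: real
  assumes "is_vector_norm N"
    and "invertible A"
    and "induced_norm N (A ** M - mat 1) \<le> \<epsilon>"
    and "\<epsilon> < 1"
  shows "invertible M \<and>
    (let M\<^sub>d = M - F in
      induced_norm N F \<le> min (\<epsilon> / induced_norm N A) ((1 - \<epsilon>) / induced_norm N A) \<longrightarrow>
        ((induced_norm N (A ** M - mat 1) < \<epsilon> \<or> induced_norm N F < (1 - \<epsilon>) / induced_norm N A)
           \<longrightarrow> invertible M\<^sub>d) \<and>
        induced_norm N (A ** M\<^sub>d - mat 1) \<le> min 1 (2 * \<epsilon>) \<and>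
        (\<epsilon> < 1 / 2 \<longrightarrow>
           invertible M\<^sub>d \<and>
           induced_norm N F \<le> \<epsilon> / induced_norm N A \<and>
           induced_norm N (A ** M\<^sub>d - mat 1) \<le> 2 * \<epsilon>))"
proof -
  note N = assms(1)
  have "invertible M"
    using assms by (intro invertible_if_approx_right_inverse[OF N, of A]) simp
  \<comment> \<open>A vector outside the kernel of \<open>A\<close> makes
    \<open>induced_norm N A\<close> positive, so the bounds on \<open>F\<close> can be multiplied
    out.\<close>
  moreover have "A *v 1 \<noteq> 0"
    using \<open>invertible A\<close> vec_eq_iff[of "1 :: 'a ^ 'n" 0]
    by (auto simp: invertible_left_inverse matrix_left_invertible_ker)
  then have "induced_norm N A > 0"
    by (rule induced_norm_pos[OF N])
  moreover have "A ** (M - F) - mat 1 = (A ** M - mat 1) - A ** F"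
    by (simp add: vec_eq_iff matrix_matrix_mult_def right_diff_distrib sum_subtractf)
  then have "induced_norm N (A ** (M - F) - mat 1)
      \<le> induced_norm N (A ** M - mat 1) + induced_norm N (A ** F)"
    by (simp only: induced_norm_diff[OF N])
  then have "induced_norm N (A ** (M - F) - mat 1)
      \<le> induced_norm N (A ** M - mat 1) + induced_norm N A * induced_norm N F"
    using induced_norm_mult[OF N, of A F] by linarith
  moreover note invertible_if_approx_right_inverse[OF N, of A "M - F"] assms(3,4)
  ultimately show ?thesis
    \<comment> \<open>The product of the norms of \<open>A\<close> and \<open>F\<close> is at most
      both \<epsilon> and 1 - \<epsilon>. Adding the residual bound \<epsilon> gives 2 * \<epsilon>
      and 1; the total is below 1 if either summand is strictly smaller or \<epsilon> < 1/2, and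
      then \<open>M - F\<close> is invertible.\<close>
    by (auto simp: Let_def pos_le_divide_eq pos_less_divide_eq mult.commute)
qed

end
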